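(* Fix a real number $p$ with $0<p<1/2$. There is a constant $C=C(p)>0$ such that for every integer $n$ with $n>\frac1p(1+\log n)$ there exist an integer $k\ge 0$ and a 2D $p$-bounded RC encoder, that is, a map $\mathrm{Enc}:\{0,1\}^k\to\{0,1\}^{n\times n}$ with $\mathrm{Enc}(x)\in \mathrm{B}_{\mathrm{RC}}(n;p)$ for all $x\in\{0,1\}^k$ together with a map $\mathrm{Dec}:\{0,1\}^{n\times n}\to\{0,1\}^k$ satisfying $\mathrm{Dec}(\mathrm{Enc}(x))=x$ for all $x\in\{0,1\}^k$, whose redundancy satisfies $$n^2-k\le n\,\lambda(n,p)+C\,n\log n .$$
   Context: Logarithms are to base 2. The weight $\mathrm{wt}(x)$ of a binary sequence $x$ is its number of ones. A binary sequence of length $m$ is $p$-bounded if its weight is at most $pm$. $\mathrm{B}_{\mathrm{RC}}(n;p)$ is the set of all $n\times n$ binary arrays in which every row and every column is $p$-bounded. Let $\mathbf S(n,p)=\{x\in\{0,1\}^n:\mathrm{wt}(x)\le pn\}$ and $\lambda(n,p)=n-\log|\mathbf S(n,p)|$. The redundancy of an encoder $\{0,1\}^k\to\{0,1\}^{n\times n}$ is $n^2-k$. *)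

theory Defs
  imports Complex_Main "HOL-Library.FuncSet"
begin

definition bin_seqs :: "nat \<Rightarrow> bool list set" where
  "bin_seqs m = {x. length x = m}"

(* An n x n binary array is the list of its n rows. *)
definition bin_arrays :: "nat \<Rightarrow> bool list list set" where
  "bin_arrays n = {A. length A = n \<and> (\<forall>r\<in>set A. r \<in> bin_seqs n)}"

definition column :: "bool list list \<Rightarrow> nat \<Rightarrow> bool list" where
  "column A j = map (\<lambda>r. r ! j) A"

definition wt :: "bool list \<Rightarrow> nat" where
  "wt x = count_list x True"

definition bounded_seq :: "real \<Rightarrow> bool list \<Rightarrow> bool" where
  "bounded_seq p x \<longleftrightarrow> real (wt x) \<le> p * real (length x)"

definition B_RC :: "nat \<Rightarrow> real \<Rightarrow> bool list list set" where
  "B_RC n p = {A \<in> bin_arrays n.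
     (\<forall>i<n. bounded_seq p (A ! i)) \<and> (\<forall>j<n. bounded_seq p (column A j))}"

definition S_set :: "nat \<Rightarrow> real \<Rightarrow> bool list set" where
  "S_set n p = {x \<in> bin_seqs n. real (wt x) \<le> p * real n}"

definition lam :: "nat \<Rightarrow> real \<Rightarrow> real" where
  "lam n p = real n - log 2 (real (card (S_set n p)))"

definition RC_encoder ::
  "nat \<Rightarrow> real \<Rightarrow> nat \<Rightarrow> (bool list \<Rightarrow> bool list list) \<Rightarrow> (bool list list \<Rightarrow> bool list) \<Rightarrow> bool" where
  "RC_encoder n p k Enc Dec \<longleftrightarrow>
     Enc \<in> bin_seqs k \<rightarrow> B_RC n p \<and>
     Dec \<in> bin_arrays n \<rightarrow> bin_seqs k \<and>
     (\<forall>x\<in>bin_seqs k. Dec (Enc x) = x)"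

(* Real-valued, so that the difference is not truncated. *)
definition redundancy :: "nat \<Rightarrow> nat \<Rightarrow> real" where
  "redundancy n k = (real n)\<^sup>2 - real k"

end

(* A counting argument replaces an explicit encoder.  Let w = floor(p n).  If an array has rows of
   weight at most w but some column b of weight more than w, then by averaging some column a has
   weight less than w.  Exchanging the entries of columns a and b in the first t rows moves the
   weight of column a from below w to above w in steps of at most 1, so some t makes it exactly w.
   Row weights do not change, and the number of columns of weight different from w drops, so n such
   exchanges lead into B_RC(n;p).  An exchange is an involution with n^2 (n+1) possible parameters,
   whence |S(n,p)|^n <= (n^2 (n+1))^n |B_RC(n;p)|, and any injection of {0,1}^k into B_RC(n;p) with
   k = floor (log |B_RC(n;p)|) is an encoder. *)

theory Submission
  imports Defs "HOL-Library.Multiset"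
begin

subsection \<open>Exchanging two columns in an initial segment of the rows\<close>

definition swap_entries :: "nat \<Rightarrow> nat \<Rightarrow> 'a list \<Rightarrow> 'a list" where
  "swap_entries a b r = r[b := r ! a, a := r ! b]"

text \<open>The parameters form one triple, so that pairs of a triple and an array range over a
  product set that can be counted.\<close>

definition prefix_swap :: "nat \<times> nat \<times> nat \<Rightarrow> 'a list list \<Rightarrow> 'a list list" where
  "prefix_swap = (\<lambda>(a, b, t) A. map (swap_entries a b) (take t A) @ drop t A)"

lemma length_swap_entries [simp]: "length (swap_entries a b r) = length r"
  by (simp add: swap_entries_def)

lemma swap_entries_swap_entries:
  "a < length r \<Longrightarrow> b < length r \<Longrightarrow> swap_entries a b (swap_entries a b r) = r"
  by (rule nth_equalityI) (auto simp: swap_entries_def nth_list_update)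

lemma wt_swap_entries:
  assumes "a < length r" "b < length r"
  shows "wt (swap_entries a b r) = wt r"
proof -
  have "mset (swap_entries a b r) = mset r"
    using assms by (simp add: swap_entries_def mset_swap)
  then show ?thesis
    unfolding wt_def by (metis count_mset)
qed

lemma nth_swap_entries:
  assumes "a < length r" "b < length r"
  shows "swap_entries a b r ! j = (if j = a then r ! b else if j = b then r ! a else r ! j)"
  using assms by (auto simp: swap_entries_def nth_list_update)

lemma length_prefix_swap [simp]: "length (prefix_swap (a, b, t) A) = length A"
  by (simp add: prefix_swap_def)

lemma bin_arrays_iff: "A \<in> bin_arrays n \<longleftrightarrow> length A = n \<and> (\<forall>r\<in>set A. length r = n)"
  by (simp add: bin_arrays_def bin_seqs_def)

text \<open>The exchange preserves lengths, so \<open>t\<close> marks the same rows both times. This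
  is what lets an array be recovered from its improved version and the triple.\<close>

lemma prefix_swap_prefix_swap:
  assumes "\<And>r. r \<in> set A \<Longrightarrow> a < length r \<and> b < length r"
  shows "prefix_swap (a, b, t) (prefix_swap (a, b, t) A) = A"
proof -
  have "swap_entries a b (swap_entries a b r) = r" if "r \<in> set (take t A)" for r
    using assms in_set_takeD[OF that] by (simp add: swap_entries_swap_entries)
  then have "map (swap_entries a b) (map (swap_entries a b) (take t A)) = take t A"
    by (simp add: map_idI)
  then have "prefix_swap (a, b, t) (prefix_swap (a, b, t) A) = take t A @ drop t A"
    by (cases "t \<le> length A") (auto simp: prefix_swap_def)
  then show ?thesis by simp
qed

subsection \<open>Weights of columns\<close>

abbreviation colwt :: "bool list list \<Rightarrow> nat \<Rightarrow> nat" where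
  "colwt A j \<equiv> wt (column A j)"

lemma wt_simps [simp]:
  "wt [] = 0" "wt (x # xs) = of_bool x + wt xs" "wt (xs @ ys) = wt xs + wt ys"
  by (auto simp: wt_def)

lemma column_simps [simp]:
  "column [] j = []" "column (r # A) j = r ! j # column A j"
  "column (A @ B) j = column A j @ column B j"
  by (auto simp: column_def)

lemma wt_eq_sum_nth: "wt r = (\<Sum>j<length r. of_bool (r ! j))"
  by (induction r) (simp_all add: sum.lessThan_Suc_shift del: sum.lessThan_Suc)

text \<open>Double counting of the ones, one row at a time. It turns the bound on rows into a bound
  on the average column weight.\<close>

lemma sum_colwt:
  assumes "\<And>r. r \<in> set A \<Longrightarrow> length r = n"
  shows "(\<Sum>j<n. colwt A j) = sum_list (map wt A)"
  using assms
proof (induction A)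
  case (Cons r A)
  then have "wt r = (\<Sum>j<n. of_bool (r ! j))"
    using wt_eq_sum_nth[of r] by simp
  with Cons show ?case by (simp add: sum.distrib)
qed simp

lemma column_swap_entries:
  assumes "\<And>r. r \<in> set A \<Longrightarrow> a < length r \<and> b < length r"
  shows "column (map (swap_entries a b) A) j =
    column A (if j = a then b else if j = b then a else j)"
  using assms by (auto simp: column_def nth_swap_entries)

lemma column_prefix_swap:
  assumes "\<And>r. r \<in> set A \<Longrightarrow> a < length r \<and> b < length r"
  shows "column (prefix_swap (a, b, t) A) j =
    column (take t A) (if j = a then b else if j = b then a else j) @ column (drop t A) j"
proof -
  have "column (map (swap_entries a b) (take t A)) j =
    column (take t A) (if j = a then b else if j = b then a else j)"
    by (rule column_swap_entries) (use assms in_set_takeD in fast)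
  then show ?thesis by (simp add: prefix_swap_def)
qed

text \<open>Discrete intermediate value argument: as \<open>t\<close> grows from 0 to
  \<open>length A\<close>, column \<open>a\<close> turns from its old self into the old column
  \<open>b\<close>.\<close>

lemma exists_prefix_swap_colwt_eq:
  assumes A: "\<And>r. r \<in> set A \<Longrightarrow> a < length r \<and> b < length r"
    and w: "colwt A a \<le> w" "w \<le> colwt A b"
  shows "\<exists>t\<le>length A. colwt (prefix_swap (a, b, t) A) a = w"
proof -
  \<comment> \<open>The weight of column \<open>a\<close> after the exchange, as an integer so that
    steps in both directions can be measured by an absolute value.\<close>
  define f where "f t = int (colwt (take t A) b) + int (colwt (drop t A) a)" for t
  have "\<exists>t\<le>length A. f t = int w"
  proof (rule nat0_intermed_int_val)
    show "\<forall>i<length A. \<bar>f (i + 1) - f i\<bar> \<le> 1"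
    proof (intro allI impI)
      fix i assume i: "i < length A"
      \<comment> \<open>Only row \<open>i\<close> passes from the untouched part to the exchanged
        part, so \<open>f\<close> changes by the difference of two bits.\<close>
      have "take (Suc i) A = take i A @ [A ! i]" "drop i A = A ! i # drop (Suc i) A"
        using i by (simp_all add: take_Suc_conv_app_nth Cons_nth_drop_Suc)
      then show "\<bar>f (i + 1) - f i\<bar> \<le> 1"
        by (auto simp: f_def)
    qed
  qed (use w in \<open>auto simp: f_def\<close>)
  moreover have "int (colwt (prefix_swap (a, b, t) A) a) = f t" for t
    using column_prefix_swap[OF A] by (simp add: f_def)
  ultimately show ?thesis by (metis of_nat_eq_iff)
qed

subsection \<open>Balancing the columns of a row-bounded array\<close>

definition row_bounded :: "nat \<Rightarrow> nat \<Rightarrow> bool list list set" where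
  "row_bounded n w = {A \<in> bin_arrays n. \<forall>r\<in>set A. wt r \<le> w}"

definition rc_bounded :: "nat \<Rightarrow> nat \<Rightarrow> bool list list set" where
  "rc_bounded n w = {A \<in> row_bounded n w. \<forall>j<n. colwt A j \<le> w}"

text \<open>Light columns are counted along with heavy ones: after an exchange column
  \<open>b\<close> may still be too heavy, and only column \<open>a\<close> is sure to have been
  repaired.\<close>

definition off_columns :: "nat \<Rightarrow> nat \<Rightarrow> bool list list \<Rightarrow> nat set" where
  "off_columns n w A = {j. j < n \<and> colwt A j \<noteq> w}"

definition swap_params :: "nat \<Rightarrow> (nat \<times> nat \<times> nat) set" where
  "swap_params n = {..<n} \<times> {..<n} \<times> {..n}"

lemma prefix_swap_in_row_bounded:
  assumes "A \<in> row_bounded n w" "a < n" "b < n"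
  shows "prefix_swap (a, b, t) A \<in> row_bounded n w"
proof -
  have "length r = n \<and> wt r \<le> w" if "r \<in> set A" for r
    using assms that by (auto simp: row_bounded_def bin_arrays_iff)
  then have "length r = n \<and> wt r \<le> w" if "r \<in> set (prefix_swap (a, b, t) A)" for r
    using that assms
    by (auto simp: prefix_swap_def wt_swap_entries dest!: in_set_takeD in_set_dropD)
  then show ?thesis
    using assms by (auto simp: row_bounded_def bin_arrays_iff)
qed

text \<open>Stated backwards, with \<open>A\<close> as the image of the better array
  \<open>A'\<close>, because the counting bounds a set by the number of its possible
  preimages.\<close>

lemma exists_prefix_swap_fewer_off_columns:
  assumes A: "A \<in> row_bounded n w" and "A \<notin> rc_bounded n w"
  shows "\<exists>q\<in>swap_params n. \<exists>A'\<in>row_bounded n w.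
    A = prefix_swap q A' \<and> card (off_columns n w A') < card (off_columns n w A)"
proof -
  have rows: "length A = n" "\<And>r. r \<in> set A \<Longrightarrow> length r = n" "\<And>r. r \<in> set A \<Longrightarrow> wt r \<le> w"
    using A by (auto simp: row_bounded_def bin_arrays_iff)
  obtain b where b: "b < n" "colwt A b > w"
    using assms by (auto simp: rc_bounded_def not_le)
  obtain a where a: "a < n" "colwt A a < w"
  proof (rule ccontr)
    \<comment> \<open>Otherwise the heavy column \<open>b\<close> would push the total above n * w,
      while n rows of weight at most w hold no more than n * w ones.\<close>
    assume "\<not> thesis"
    with that have "\<forall>j<n. w \<le> colwt A j" by (meson not_le)
    with b have "(\<Sum>j<n. w) < (\<Sum>j<n. colwt A j)"
      by (intro sum_strict_mono_ex1) auto
    also have "\<dots> = sum_list (map wt A)"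
      using rows by (intro sum_colwt)
    also have "\<dots> \<le> sum_list (map (\<lambda>_. w) A)"
      using rows by (intro sum_list_mono)
    finally show False
      using rows by (simp add: sum_list_triv)
  qed
  have ab: "\<And>r. r \<in> set A \<Longrightarrow> a < length r \<and> b < length r"
    using rows a b by auto
  have "\<exists>t\<le>length A. colwt (prefix_swap (a, b, t) A) a = w"
    by (rule exists_prefix_swap_colwt_eq) (use ab a b in \<open>simp_all add: less_imp_le\<close>)
  then obtain t where t: "t \<le> n" "colwt (prefix_swap (a, b, t) A) a = w"
    using rows(1) by blast
  define A' where "A' = prefix_swap (a, b, t) A"
  have other: "colwt A' j = colwt A j" if "j \<noteq> a" "j \<noteq> b" for j
  proof -
    have "column A' j = column (take t A) j @ column (drop t A) j"
      unfolding A'_def by (subst column_prefix_swap) (use ab that in simp_all)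
    also have "\<dots> = column A j"
      by (metis append_take_drop_id column_simps(3))
    finally show ?thesis by simp
  qed
  have "off_columns n w A' \<subset> off_columns n w A"
  proof (rule psubsetI)
    show "off_columns n w A' \<subseteq> off_columns n w A"
    proof
      fix j assume j: "j \<in> off_columns n w A'"
      then have "j \<noteq> a" using t(2) by (auto simp: off_columns_def A'_def)
      \<comment> \<open>Column \<open>b\<close> is in the set for \<open>A\<close> already, whatever
        its new weight; columns other than \<open>a\<close> and \<open>b\<close> are
        unchanged.\<close>
      then show "j \<in> off_columns n w A"
        using j b other[of j] by (cases "j = b") (auto simp: off_columns_def)
    qed
    have "a \<in> off_columns n w A" "a \<notin> off_columns n w A'"
      using t(2) a by (simp_all add: off_columns_def A'_def)
    then show "off_columns n w A' \<noteq> off_columns n w A" by blast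
  qed
  then have "card (off_columns n w A') < card (off_columns n w A)"
    by (intro psubset_card_mono) (auto simp: off_columns_def)
  moreover have "A = prefix_swap (a, b, t) A'"
    unfolding A'_def by (rule prefix_swap_prefix_swap[symmetric]) (rule ab)
  moreover have "A' \<in> row_bounded n w"
    unfolding A'_def using A a b by (simp add: prefix_swap_in_row_bounded)
  moreover have "(a, b, t) \<in> swap_params n"
    using a b t by (simp add: swap_params_def)
  ultimately show ?thesis by blast
qed

section \<open>Counting row-bounded arrays through chains of exchanges\<close>

lemma finite_row_bounded: "finite (row_bounded n w)"
proof (rule finite_subset)
  show "row_bounded n w \<subseteq> {A. set A \<subseteq> {r. set r \<subseteq> UNIV \<and> length r = n} \<and> length A = n}"
    by (auto simp: row_bounded_def bin_arrays_iff)
qed (intro finite_lists_length_eq finite)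

text \<open>An array in \<open>rc_bounded n w\<close> may have many light columns and hence a large
  \<open>off_columns\<close>. The union keeps all of these arrays at every level, so each further
  level costs just one factor, the number of triples.\<close>

lemma card_row_bounded_off_columns_le:
  assumes "0 < n"
  shows "card (rc_bounded n w \<union> {A \<in> row_bounded n w. card (off_columns n w A) \<le> m})
    \<le> (n * n * (n + 1)) ^ m * card (rc_bounded n w)"
proof (induction m)
  case 0
  \<comment> \<open>A failure would yield an array with fewer than zero such columns.\<close>
  have "A \<in> rc_bounded n w" if "A \<in> row_bounded n w" "card (off_columns n w A) \<le> 0" for A
    using exists_prefix_swap_fewer_off_columns that by fastforce
  then have "rc_bounded n w \<union> {A \<in> row_bounded n w. card (off_columns n w A) \<le> 0} = rc_bounded n w"
    by auto
  then show ?case by simp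
next
  case (Suc m)
  define U where
    "U i = rc_bounded n w \<union> {A \<in> row_bounded n w. card (off_columns n w A) \<le> i}" for i
  have fin: "finite (U i)" for i
    by (rule finite_subset[OF _ finite_row_bounded[of n w]]) (auto simp: U_def rc_bounded_def)
  have "U (Suc m) \<subseteq> (\<lambda>(q, A). prefix_swap q A) ` (swap_params n \<times> U m)"
  proof
    fix A assume A: "A \<in> U (Suc m)"
    have "\<exists>q\<in>swap_params n. \<exists>A'\<in>U m. A = prefix_swap q A'"
    proof (cases "A \<in> rc_bounded n w")
      case True
      \<comment> \<open>With \<open>t = 0\<close> the exchange is the identity, which carries these
        arrays from one level to the next.\<close>
      have "A = prefix_swap (0, 0, 0) A" by (simp add: prefix_swap_def)
      moreover have "(0, 0, 0) \<in> swap_params n"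
        using assms by (simp add: swap_params_def)
      ultimately show ?thesis using True unfolding U_def by blast
    next
      case False
      with A have "A \<in> row_bounded n w" "card (off_columns n w A) \<le> Suc m"
        by (auto simp: U_def)
      with exists_prefix_swap_fewer_off_columns[OF _ False] show ?thesis
        unfolding U_def by fastforce
    qed
    then show "A \<in> (\<lambda>(q, A). prefix_swap q A) ` (swap_params n \<times> U m)"
      by auto
  qed
  then have "card (U (Suc m)) \<le> card (swap_params n \<times> U m)"
    by (intro surj_card_le) (auto simp: swap_params_def fin)
  also have "\<dots> = (n * n * (n + 1)) * card (U m)"
    by (simp add: swap_params_def card_cartesian_product algebra_simps)
  also have "\<dots> \<le> (n * n * (n + 1)) * ((n * n * (n + 1)) ^ m * card (rc_bounded n w))"
    using Suc.IH unfolding U_def by (intro mult_left_mono) auto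
  finally show ?case unfolding U_def by (simp only: power_Suc mult.assoc)
qed

lemma card_row_bounded_le:
  assumes "0 < n"
  shows "card (row_bounded n w) \<le> (n * n * (n + 1)) ^ n * card (rc_bounded n w)"
proof -
  have "card (off_columns n w A) \<le> n" for A
    using card_mono[of "{..<n}" "off_columns n w A"] by (auto simp: off_columns_def)
  then have "rc_bounded n w \<union> {A \<in> row_bounded n w. card (off_columns n w A) \<le> n} = row_bounded n w"
    by (auto simp: rc_bounded_def)
  then show ?thesis
    using card_row_bounded_off_columns_le[OF assms, of w n] by simp
qed

subsection \<open>The encoder\<close>

lemma finite_bin_seqs: "finite (bin_seqs k)" and card_bin_seqs: "card (bin_seqs k) = 2 ^ k"
  using finite_lists_length_eq[of "UNIV :: bool set" k] card_lists_length_eq[of "UNIV :: bool set" k]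
  by (simp_all add: bin_seqs_def)

lemma real_le_iff_le_nat_floor: "0 \<le> x \<Longrightarrow> real m \<le> x \<longleftrightarrow> m \<le> nat \<lfloor>x\<rfloor>"
  by (simp add: le_nat_iff le_floor_iff)

text \<open>Weights are integers, so the real threshold p * n may be rounded down to the w of the
  combinatorial part.\<close>

lemma B_RC_eq_rc_bounded:
  assumes "0 \<le> p"
  shows "B_RC n p = rc_bounded n (nat \<lfloor>p * real n\<rfloor>)"
proof -
  have "A \<in> B_RC n p \<longleftrightarrow> A \<in> rc_bounded n (nat \<lfloor>p * real n\<rfloor>)" if A: "A \<in> bin_arrays n" for A
  proof -
    have len: "length A = n" "\<And>i. i < n \<Longrightarrow> length (A ! i) = n" "length (column A j) = n" for j
      using A by (auto simp: bin_arrays_iff column_def)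
    have "(\<forall>i<n. bounded_seq p (A ! i)) \<longleftrightarrow> (\<forall>r\<in>set A. wt r \<le> nat \<lfloor>p * real n\<rfloor>)"
      using assms len by (simp add: bounded_seq_def real_le_iff_le_nat_floor all_set_conv_all_nth)
    moreover have "(\<forall>j<n. bounded_seq p (column A j)) \<longleftrightarrow> (\<forall>j<n. colwt A j \<le> nat \<lfloor>p * real n\<rfloor>)"
      using assms len by (simp add: bounded_seq_def real_le_iff_le_nat_floor)
    ultimately show ?thesis
      using A by (simp add: B_RC_def rc_bounded_def row_bounded_def)
  qed
  moreover have "B_RC n p \<subseteq> bin_arrays n" "rc_bounded n (nat \<lfloor>p * real n\<rfloor>) \<subseteq> bin_arrays n"
    by (auto simp: B_RC_def rc_bounded_def row_bounded_def)
  ultimately show ?thesis by blast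
qed

text \<open>With no condition on columns, the n rows are chosen independently from
  \<open>S_set n p\<close>.\<close>

lemma card_row_bounded:
  assumes "0 \<le> p"
  shows "card (row_bounded n (nat \<lfloor>p * real n\<rfloor>)) = card (S_set n p) ^ n"
proof -
  have "row_bounded n (nat \<lfloor>p * real n\<rfloor>) = {A. set A \<subseteq> S_set n p \<and> length A = n}"
    using assms
    by (auto simp: row_bounded_def bin_arrays_def S_set_def real_le_iff_le_nat_floor)
  moreover have "finite (S_set n p)"
    by (rule finite_subset[OF _ finite_bin_seqs[of n]]) (auto simp: S_set_def)
  ultimately show ?thesis by (simp add: card_lists_length_eq)
qed

lemma exists_RC_encoder:
  assumes "2 ^ k \<le> card (B_RC n p)"
  shows "\<exists>Enc Dec. RC_encoder n p k Enc Dec"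
proof -
  have "card (B_RC n p) \<noteq> 0"
    using assms by (metis le_zero_eq power_eq_0_iff zero_neq_numeral)
  then have "finite (B_RC n p)" by (meson card.infinite)
  then obtain f where f: "f ` bin_seqs k \<subseteq> B_RC n p" "inj_on f (bin_seqs k)"
    using card_le_inj[OF finite_bin_seqs] assms card_bin_seqs by metis
  \<comment> \<open>The all-zero default makes the decoder return a word of length \<open>k\<close>
    on arrays outside the image of \<open>f\<close> too.\<close>
  define g where
    "g Y = (if Y \<in> f ` bin_seqs k then inv_into (bin_seqs k) f Y else replicate k False)" for Y
  have "g Y \<in> bin_seqs k" for Y
    by (auto simp: g_def inv_into_into) (simp add: bin_seqs_def)
  moreover have "g (f x) = x" if "x \<in> bin_seqs k" for x
    using f that by (simp add: g_def)
  ultimately have "RC_encoder n p k f g"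
    using f unfolding RC_encoder_def by auto
  then show ?thesis by blast
qed

text \<open>For n at least 2, n + 1 \<le> n^2, so each of the n exchanges has at most n^4 parameters
  and costs at most 4 log n bits.\<close>

lemma log_card_B_RC_ge:
  assumes "0 \<le> p" "2 \<le> n"
  shows "0 < card (B_RC n p)"
    and "real n * log 2 (card (S_set n p)) - 4 * real n * log 2 n \<le> log 2 (card (B_RC n p))"
proof -
  define s where "s = card (S_set n p)"
  define c where "c = card (B_RC n p)"
  \<comment> \<open>The all-zero word makes \<open>S_set n p\<close> nonempty, so the logarithms
    below have positive arguments.\<close>
  have "wt (replicate n False) = 0" by (induction n) auto
  then have "replicate n False \<in> S_set n p"
    using assms by (simp add: S_set_def bin_seqs_def)
  moreover have "finite (S_set n p)"
    by (rule finite_subset[OF _ finite_bin_seqs[of n]]) (auto simp: S_set_def)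
  ultimately have s: "0 < s" unfolding s_def using card_gt_0_iff by blast
  have "s ^ n \<le> (n * n * (n + 1)) ^ n * c"
    using card_row_bounded_le[of n "nat \<lfloor>p * real n\<rfloor>"] assms
    by (simp add: s_def c_def card_row_bounded B_RC_eq_rc_bounded)
  also have "\<dots> \<le> (n ^ 4) ^ n * c"
  proof -
    have "n + 1 \<le> n * n" using assms(2) mult_le_mono1[of 2 n n] by linarith
    then have "n * n * (n + 1) \<le> n * n * (n * n)" by (rule mult_le_mono2)
    then have "n * n * (n + 1) \<le> n ^ 4" by (simp add: power4_eq_xxxx mult.assoc)
    then show ?thesis by (intro mult_right_mono power_mono) auto
  qed
  finally have le: "s ^ n \<le> (n ^ 4) ^ n * c" .
  then show c: "0 < card (B_RC n p)"
    using s c_def by (metis gr0I le_zero_eq mult_0_right power_eq_0_iff not_gr_zero)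
  from le have "real (s ^ n) \<le> real ((n ^ 4) ^ n * c)" by (rule of_nat_mono)
  then have "log 2 (real s ^ n) \<le> log 2 ((real n ^ 4) ^ n * real c)"
    using s by (intro log_mono) auto
  also have "\<dots> = log 2 ((real n ^ 4) ^ n) + log 2 c"
    using c c_def assms by (simp add: log_mult_pos)
  finally have "real n * log 2 s \<le> real n * (4 * log 2 n) + log 2 c"
    using s assms by (simp add: log_nat_power)
  then show "real n * log 2 (card (S_set n p)) - 4 * real n * log 2 n \<le> log 2 (card (B_RC n p))"
    by (simp add: s_def c_def)
qed

theorem mainTheorem1:
  fixes p :: real
  assumes "0 < p" and "p < 1/2"
  shows "\<exists>C::real. C > 0 \<and>
    (\<forall>n::nat. real n > (1/p) * (1 + log 2 (real n)) \<longrightarrow>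
      (\<exists>k::nat. \<exists>Enc Dec. RC_encoder n p k Enc Dec \<and>
        redundancy n k \<le> real n * lam n p + C * real n * log 2 (real n)))"
proof (rule exI[of _ 5], intro conjI allI impI)
  \<comment> \<open>In the constant 5, the exchanges account for 4 and the rounding of
    \<open>k\<close> for 1.\<close>
  fix n :: nat
  assume n: "real n > (1/p) * (1 + log 2 (real n))"
  \<comment> \<open>The assumption on \<open>n\<close> rules out 0, where the logarithm is 0 by
    convention and 0 > 1/p would follow, and 1, where it reads 1 > 1/p.\<close>
  have "2 < 1/p" using assms by (simp add: field_simps)
  moreover have "n \<noteq> 0"
  proof
    assume "n = 0"
    with n assms show False by (simp add: log_def field_simps)
  qed
  moreover have "n \<noteq> 1"
    using n calculation by auto
  ultimately have n2: "2 \<le> n" by linarith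
  define c where "c = card (B_RC n p)"
  define k where "k = nat \<lfloor>log 2 c\<rfloor>"
  have c: "1 \<le> real c"
    and log_c: "real n * log 2 (card (S_set n p)) - 4 * real n * log 2 n \<le> log 2 c"
    using log_card_B_RC_ge[of p n] assms n2 by (auto simp: c_def Suc_le_eq)
  then have "0 \<le> log 2 c" by simp
  then have k: "real k \<le> log 2 c" "log 2 c - 1 \<le> real k"
    unfolding k_def by linarith+
  have "2 powr real k \<le> real c"
    using k c by (simp add: le_log_iff)
  then have "2 ^ k \<le> c"
    by (simp add: powr_realpow)
  then obtain Enc Dec where enc: "RC_encoder n p k Enc Dec"
    using exists_RC_encoder unfolding c_def by blast
  \<comment> \<open>Rounding loses at most one bit, which n log n \<ge> 1 absorbs.\<close>
  have "1 \<le> log 2 n" using n2 by simp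
  then have "1 * 1 \<le> real n * log 2 n"
    using n2 by (intro mult_mono) auto
  moreover have "redundancy n k \<le> (real n)\<^sup>2 - log 2 c + 1"
    using k by (simp add: redundancy_def)
  ultimately have "redundancy n k \<le> real n * lam n p + 5 * real n * log 2 n"
    using log_c by (simp add: lam_def algebra_simps power2_eq_square)
  with enc show "\<exists>k Enc Dec. RC_encoder n p k Enc Dec \<and>
      redundancy n k \<le> real n * lam n p + 5 * real n * log 2 (real n)"
    by blast
qed simp

end
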